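(* Let $M$ be a $C^1$ manifold and let $\widetilde{\Omega}\subset TM$ be a weak Finsler structure on $M$, with harmonic symmetrization $\mathcal{H}(\widetilde{\Omega})$. Then: (1) The arithmetic symmetrization of the length structure $\ell_{\widetilde{\Omega}}$ associated to $\widetilde{\Omega}$ is the length structure $\ell_{\mathcal{H}(\widetilde{\Omega})}$ associated to $\mathcal{H}(\widetilde{\Omega})$; that is, for every piecewise $C^1$ path $\gamma$ in $M$, $$\ell_{\mathcal{H}(\widetilde{\Omega})}(\gamma)=\tfrac12\left(\ell_{\widetilde{\Omega}}(\gamma)+\ell_{\widetilde{\Omega}}(\gamma^{-1})\right).$$ (2) Suppose that for every $x$ and $y$ in $M$ there exists a bi-minimal path (with respect to $\ell_{\widetilde{\Omega}}$) joining $x$ to $y$. Then the distance associated to $\mathcal{H}(\widetilde{\Omega})$ is the arithmetic symmetrization of the distance $d_{\widetilde{\Omega}}$; that is, for all $x,y\in M$, $$d_{\mathcal{H}(\widetilde{\Omega})}(x,y)=\tfrac12\left(d_{\widetilde{\Omega}}(x,y)+d_{\widetilde{\Omega}}(y,x)\right).$$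
   Context: **Weak Finsler structure.** A weak Finsler structure on a $C^1$ manifold $M$ is a subset $\widetilde{\Omega}\subset TM$ such that for each $x\in M$ the set $\widetilde{\Omega}_x=\widetilde{\Omega}\cap T_xM$ is a convex subset of $T_xM$ containing the origin. Its Lagrangian is the function $p_{\widetilde{\Omega}}:TM\to[0,\infty]$, $p_{\widetilde{\Omega}}(x,\xi)=\inf\{t>0 \mid t^{-1}\xi\in\widetilde{\Omega}_x\}$ (with $\inf\emptyset=\infty$). The Lagrangian is taken to be Borel-measurable, so that the integrals below are well defined. **Length and distance.** Let $\Gamma$ be the set of all piecewise $C^1$ paths $\gamma:[a,b]\to M$. The length structure associated to $\widetilde{\Omega}$ is $\ell_{\widetilde{\Omega}}(\gamma)=\int_a^b p_{\widetilde{\Omega}}(\gamma(t),\dot\gamma(t))\,dt\in[0,\infty]$, and the associated distance is $d_{\widetilde{\Omega}}(x,y)=\inf \ell_{\widetilde{\Omega}}(\gamma)\in[0,\infty]$, the infimum being over all $\gamma\in\Gamma$ joining $x$ to $y$ (with $\inf\emptyset=\infty$). The reverse path is $\gamma^{-1}(t)=\gamma(a+b-t)$. The arithmetic symmetrization of a length structure $\ell$ is ${}^s\ell(\gamma)=\frac12(\ell(\gamma)+\ell(\gamma^{-1}))$. A path $\gamma\in\Gamma$ from $x$ to $y$ is bi-minimal if $\ell_{\widetilde{\Omega}}(\gamma)=d_{\widetilde{\Omega}}(x,y)$ and $\ell_{\widetilde{\Omega}}(\gamma^{-1})=d_{\widetilde{\Omega}}(y,x)$. **Harmonic symmetrization of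 an interval.** Let $I$ be an interval contained in an affine line, with (possibly infinite) endpoints $a_1,a_2$, and let $x\in I$. Define $\rho\in[0,\infty]$ by $\frac1\rho=\frac12\left(\frac1{|a_1-x|}+\frac1{|a_2-x|}\right)$, with $1/\infty=0$ and $1/0=\infty$. The harmonic symmetrization $\mathcal{H}(I,x)$ is the interval of the same line centered at $x$ with half-length $\rho$. It is closed if $I$ is closed (in particular for closed rays) and open if $I$ is open. If $I$ is bounded and half-open, it is half-open and contains its endpoint on the side of the endpoint of $I$ belonging to $I$. It is the whole line if $I$ is the whole line, and it is $\{x\}$ if $\rho=0$. **Harmonic symmetrization of a convex set and of a weak Finsler structure.** For a convex set $C$ in a finite-dimensional real vector space $V$ and $x\in C$, $\mathcal{H}(C,x)$ is the union, over all lines $L$ through $x$, of $\mathcal{H}(L\cap C,x)$; this does not depend on the choice of a Euclidean norm on $V$. The harmonic symmetrization of a weak Finsler structure $\widetilde{\Omega}$ is $\mathcal{H}(\widetilde{\Omega})=\bigcup_{x\in M}\mathcal{H}(\widetilde{\Omega}_x,0)\subset TM$, the symmetrization being taken in each tangent space $T_xM$ with respect to its origin; it is again a weak Finsler structure. *)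

theory Defs
  imports "HOL-Analysis.Analysis" "HOL-Library.Function_Algebras"
begin

text \<open>Pointwise real vector space structure on function spaces; tangent vectors will be
  functions assigning to each chart a coordinate vector.\<close>

instantiation "fun" :: (type, real_vector) real_vector
begin

definition scaleR_fun_def: "scaleR r f = (\<lambda>x. scaleR r (f x))"

instance
  by standard (simp_all add: scaleR_fun_def fun_eq_iff algebra_simps)

end


section \<open>\<open>C\<^sup>1\<close> manifolds\<close>

text \<open>A chart is a pair of a domain and a coordinate map; the values of the coordinate map
  outside the domain are irrelevant.\<close>

type_synonym ('a, 'e) chart = "'a set \<times> ('a \<Rightarrow> 'e)"

definition is_chart :: "'a topology \<Rightarrow> ('a, 'e::euclidean_space) chart \<Rightarrow> bool" where
  "is_chart M c \<longleftrightarrow> openin M (fst c) \<and> open (snd c ` fst c) \<and>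
     homeomorphic_map (subtopology M (fst c)) (top_of_set (snd c ` fst c)) (snd c)"

definition transition ::
  "('a, 'e::euclidean_space) chart \<Rightarrow> ('a, 'e) chart \<Rightarrow> 'e \<Rightarrow> 'e" where
  "transition c c' = snd c' \<circ> inv_into (fst c) (snd c)"

definition C1_on :: "'e::euclidean_space set \<Rightarrow> ('e \<Rightarrow> 'e) \<Rightarrow> bool" where
  "C1_on S f \<longleftrightarrow> (\<exists>D :: 'e \<Rightarrow> 'e \<Rightarrow>\<^sub>L 'e.
     (\<forall>y\<in>S. (f has_derivative blinfun_apply (D y)) (at y)) \<and> continuous_on S D)"

definition C1_manifold :: "'a topology \<Rightarrow> ('a, 'e::euclidean_space) chart set \<Rightarrow> bool" where
  "C1_manifold M A \<longleftrightarrow>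
     Hausdorff_space M \<and> second_countable M \<and>
     (\<forall>c\<in>A. is_chart M c) \<and> (\<Union>c\<in>A. fst c) = topspace M \<and>
     (\<forall>c\<in>A. \<forall>c'\<in>A. C1_on (snd c ` (fst c \<inter> fst c')) (transition c c'))"

definition charts_at :: "('a, 'e) chart set \<Rightarrow> 'a \<Rightarrow> ('a, 'e) chart set" where
  "charts_at A x = {c\<in>A. x \<in> fst c}"


section \<open>The tangent bundle\<close>

text \<open>A tangent vector at \<open>x\<close> is a family of coordinate vectors indexed by the charts around \<open>x\<close>
  and transforming by the derivatives of the coordinate changes. The value 0 at all other charts
  is a convention that makes the representing function unique. Evaluation at any chart around \<open>x\<close>
  identifies the tangent space linearly with the model space \<open>'e\<close>.\<close>

type_synonym ('a, 'e) tvec = "('a, 'e) chart \<Rightarrow> 'e"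

definition tangent_space ::
  "('a, 'e::euclidean_space) chart set \<Rightarrow> 'a \<Rightarrow> ('a, 'e) tvec set" where
  "tangent_space A x = {v.
     (\<forall>c. c \<notin> charts_at A x \<longrightarrow> v c = 0) \<and>
     (\<forall>c\<in>charts_at A x. \<forall>c'\<in>charts_at A x.
        v c' = frechet_derivative (transition c c') (at (snd c x)) (v c))}"

definition tangent_bundle ::
  "'a topology \<Rightarrow> ('a, 'e::euclidean_space) chart set \<Rightarrow> ('a \<times> ('a, 'e) tvec) set" where
  "tangent_bundle M A = (SIGMA x:topspace M. tangent_space A x)"

text \<open>The topology of the tangent bundle is generated by the inverse images of open sets under
  the bundle charts \<open>(x, v) \<mapsto> (\<phi> x, v\<^sub>\<phi>)\<close>.\<close>

definition tangent_bundle_topology ::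
  "'a topology \<Rightarrow> ('a, 'e::euclidean_space) chart set \<Rightarrow> ('a \<times> ('a, 'e) tvec) topology" where
  "tangent_bundle_topology M A = topology_generated_by
     {{(x, v) \<in> tangent_bundle M A. x \<in> fst c \<and> (snd c x, v c) \<in> W} | c W. c \<in> A \<and> open W}"

definition tangent_bundle_borel ::
  "'a topology \<Rightarrow> ('a, 'e::euclidean_space) chart set \<Rightarrow> ('a \<times> ('a, 'e) tvec) measure" where
  "tangent_bundle_borel M A =
     sigma (tangent_bundle M A) {W. openin (tangent_bundle_topology M A) W}"


section \<open>Weak Finsler structures\<close>

definition fibre :: "('a \<times> 'v) set \<Rightarrow> 'a \<Rightarrow> 'v set" where
  "fibre \<Omega> x = {\<xi>. (x, \<xi>) \<in> \<Omega>}"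

definition weak_Finsler_structure ::
  "'a topology \<Rightarrow> ('a, 'e::euclidean_space) chart set \<Rightarrow> ('a \<times> ('a, 'e) tvec) set \<Rightarrow> bool" where
  "weak_Finsler_structure M A \<Omega> \<longleftrightarrow> \<Omega> \<subseteq> tangent_bundle M A \<and>
     (\<forall>x\<in>topspace M. convex (fibre \<Omega> x) \<and> 0 \<in> fibre \<Omega> x)"

definition lagrangian :: "('a \<times> 'v::real_vector) set \<Rightarrow> 'a \<times> 'v \<Rightarrow> ennreal" where
  "lagrangian \<Omega> = (\<lambda>(x, \<xi>). Inf {ennreal t | t. 0 < t \<and> inverse t *\<^sub>R \<xi> \<in> fibre \<Omega> x})"


section \<open>Piecewise \<open>C\<^sup>1\<close> paths, length and distance\<close>

text \<open>Derivatives are taken within the closed interval, hence are one-sided at its endpoints.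
  A path \<open>[a, b] \<rightarrow> M\<close> is represented by \<open>a\<close>, \<open>b\<close> and a function on the reals whose
  values outside \<open>[a, b]\<close> are irrelevant.\<close>

definition C1_path ::
  "'a topology \<Rightarrow> ('a, 'e::euclidean_space) chart set \<Rightarrow> real \<Rightarrow> real \<Rightarrow> (real \<Rightarrow> 'a) \<Rightarrow> bool" where
  "C1_path M A a b \<gamma> \<longleftrightarrow>
     continuous_map (top_of_set {a..b}) M \<gamma> \<and>
     (\<forall>c\<in>A. \<exists>D. (\<forall>t\<in>{t\<in>{a..b}. \<gamma> t \<in> fst c}.
           (snd c \<circ> \<gamma> has_vector_derivative D t) (at t within {a..b})) \<and>
        continuous_on {t\<in>{a..b}. \<gamma> t \<in> fst c} D)"

definition piecewise_C1_path ::
  "'a topology \<Rightarrow> ('a, 'e::euclidean_space) chart set \<Rightarrow> real \<Rightarrow> real \<Rightarrow> (real \<Rightarrow> 'a) \<Rightarrow> bool" where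
  "piecewise_C1_path M A a b \<gamma> \<longleftrightarrow> a < b \<and>
     continuous_map (top_of_set {a..b}) M \<gamma> \<and>
     (\<exists>(n::nat) \<tau>. \<tau> 0 = a \<and> \<tau> n = b \<and>
        (\<forall>i<n. \<tau> i < \<tau> (Suc i) \<and> C1_path M A (\<tau> i) (\<tau> (Suc i)) \<gamma>))"

text \<open>At the finitely many break points of a piecewise \<open>C\<^sup>1\<close> path the velocity may be
  unspecified; this does not affect the length.\<close>

definition velocity ::
  "('a, 'e::euclidean_space) chart set \<Rightarrow> real \<Rightarrow> real \<Rightarrow> (real \<Rightarrow> 'a) \<Rightarrow> real \<Rightarrow> ('a, 'e) tvec" where
  "velocity A a b \<gamma> t = (\<lambda>c. if c \<in> charts_at A (\<gamma> t)
     then vector_derivative (snd c \<circ> \<gamma>) (at t within {a..b}) else 0)"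

type_synonym 'a length_structure = "real \<Rightarrow> real \<Rightarrow> (real \<Rightarrow> 'a) \<Rightarrow> ennreal"

definition Finsler_length ::
  "('a, 'e::euclidean_space) chart set \<Rightarrow> ('a \<times> ('a, 'e) tvec) set \<Rightarrow> 'a length_structure" where
  "Finsler_length A \<Omega> a b \<gamma> =
     (\<integral>\<^sup>+ t\<in>{a..b}. lagrangian \<Omega> (\<gamma> t, velocity A a b \<gamma> t) \<partial>lborel)"

definition Finsler_dist ::
  "'a topology \<Rightarrow> ('a, 'e::euclidean_space) chart set \<Rightarrow> ('a \<times> ('a, 'e) tvec) set \<Rightarrow>
   'a \<Rightarrow> 'a \<Rightarrow> ennreal" where
  "Finsler_dist M A \<Omega> x y =
     Inf {Finsler_length A \<Omega> a b \<gamma> | a b \<gamma>. piecewise_C1_path M A a b \<gamma> \<and> \<gamma> a = x \<and> \<gamma> b = y}"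

definition reverse_path :: "real \<Rightarrow> real \<Rightarrow> (real \<Rightarrow> 'a) \<Rightarrow> real \<Rightarrow> 'a" where
  "reverse_path a b \<gamma> = (\<lambda>t. \<gamma> (a + b - t))"

definition arith_sym_length :: "'a length_structure \<Rightarrow> 'a length_structure" where
  "arith_sym_length L a b \<gamma> = (L a b \<gamma> + L a b (reverse_path a b \<gamma>)) / 2"

definition arith_sym_dist :: "('a \<Rightarrow> 'a \<Rightarrow> ennreal) \<Rightarrow> 'a \<Rightarrow> 'a \<Rightarrow> ennreal" where
  "arith_sym_dist d x y = (d x y + d y x) / 2"

definition bi_minimal ::
  "'a topology \<Rightarrow> ('a, 'e::euclidean_space) chart set \<Rightarrow> ('a \<times> ('a, 'e) tvec) set \<Rightarrow>
   'a \<Rightarrow> 'a \<Rightarrow> real \<Rightarrow> real \<Rightarrow> (real \<Rightarrow> 'a) \<Rightarrow> bool" where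
  "bi_minimal M A \<Omega> x y a b \<gamma> \<longleftrightarrow>
     piecewise_C1_path M A a b \<gamma> \<and> \<gamma> a = x \<and> \<gamma> b = y \<and>
     Finsler_length A \<Omega> a b \<gamma> = Finsler_dist M A \<Omega> x y \<and>
     Finsler_length A \<Omega> a b (reverse_path a b \<gamma>) = Finsler_dist M A \<Omega> y x"


section \<open>Harmonic symmetrization\<close>

text \<open>For extended reals \<open>inverse \<infinity> = 0\<close> and \<open>inverse 0 = \<infinity>\<close>.\<close>

definition harmonic_radius :: "real set \<Rightarrow> real \<Rightarrow> ereal" where
  "harmonic_radius I x =
     inverse ((inverse \<bar>Inf (ereal ` I) - ereal x\<bar> + inverse \<bar>Sup (ereal ` I) - ereal x\<bar>) / 2)"

text \<open>For an interval \<open>I\<close> containing \<open>x\<close>, the last two branches are reached only if \<open>I\<close> is bounded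
  and half-open. The whole line is covered by the closed case with infinite radius.\<close>

definition harmonic_sym_interval :: "real set \<Rightarrow> real \<Rightarrow> real set" where
  "harmonic_sym_interval I x =
     (let \<rho> = harmonic_radius I x in
      if \<rho> = 0 then {x}
      else if closed I then {y. ereal \<bar>y - x\<bar> \<le> \<rho>}
      else if open I then {y. ereal \<bar>y - x\<bar> < \<rho>}
      else if Inf (ereal ` I) \<in> ereal ` I
        then {y. ereal x - \<rho> \<le> ereal y \<and> ereal y < ereal x + \<rho>}
        else {y. ereal x - \<rho> < ereal y \<and> ereal y \<le> ereal x + \<rho>})"

text \<open>\<open>V\<close> is a linear subspace containing \<open>C\<close> and \<open>x\<close>. The line through \<open>x\<close> with direction \<open>v\<close> is
  identified with the real line by \<open>s \<mapsto> x + s v\<close>, so that \<open>x\<close> corresponds to 0. Rescaling \<open>v\<close>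
  rescales all distances on the line and hence does not change the resulting subset of the line.\<close>

definition harmonic_sym :: "'v::real_vector set \<Rightarrow> 'v set \<Rightarrow> 'v \<Rightarrow> 'v set" where
  "harmonic_sym V C x =
     (\<Union>v\<in>V - {0}. (\<lambda>s. x + s *\<^sub>R v) ` harmonic_sym_interval {s. x + s *\<^sub>R v \<in> C} 0)"

definition harmonic_sym_structure ::
  "'a topology \<Rightarrow> ('a, 'e::euclidean_space) chart set \<Rightarrow>
   ('a \<times> ('a, 'e) tvec) set \<Rightarrow> ('a \<times> ('a, 'e) tvec) set" where
  "harmonic_sym_structure M A \<Omega> =
     (SIGMA x:topspace M. harmonic_sym (tangent_space A x) (fibre \<Omega> x) 0)"

end

theory Submission
  imports Defs
begin

text \<open>
  Fix a point and let \<open>C\<close> be the fibre of the Finsler structure there, \<open>p\<close> its gauge. On the line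
  spanned by a tangent vector \<open>v\<close> the set \<open>C\<close> is an interval around 0 whose two ends lie at
  distances \<open>1 / p v\<close> and \<open>1 / p (- v)\<close> in the parameter of the line. The harmonic mean of
  these distances is the inverse of \<open>N v = (p v + p (- v)) / 2\<close>, so harmonic symmetrization of
  the set is arithmetic symmetrization of the gauge. Whichever end points the symmetrized interval
  contains, the symmetrized set lies between \<open>{N < 1}\<close> and \<open>{N \<le> 1}\<close>, and this
  determines its gauge (\<open>minkowski_gauge_harmonic_sym\<close>). The zero vector needs a separate
  argument: the symmetrization is a union over lines, hence empty if there is no line. This is
  where it matters that tangent spaces are nontrivial, which follows from the cocycle rule for
  coordinate changes (\<open>tangent_space_nontrivial\<close>).

  Integrating the pointwise identity along a path gives the first assertion, once two facts are
  available. The integral of the sum must split, for which the Lagrangian along the path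
  has to be measurable. Off a finite set of times the velocity is a continuous curve in the tangent
  bundle (\<open>lift_continuous\<close>), so measurability is inherited from the Lagrangian on the
  bundle. Moreover the integral of \<open>p (- v)\<close> must be the length of the reverse path, which is
  the substitution \<open>t \<mapsto> a + b - t\<close> together with \<open>velocity_reverse_path\<close>.

  For the second assertion, the first one bounds the symmetrized length of any path from below by
  the symmetrized distance of its end points, since the reverse path competes in the infimum
  for the opposite direction; a bi-minimal path attains this bound.
\<close>

section \<open>Gauges and their symmetrization\<close>

definition minkowski_gauge :: "'v::real_vector set \<Rightarrow> 'v \<Rightarrow> ennreal" where
  "minkowski_gauge C v = Inf {ennreal t | t. 0 < t \<and> inverse t *\<^sub>R v \<in> C}"

text \<open>The arithmetic symmetrization of the gauge, which turns out to be the gauge of the harmonic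
  symmetrization.\<close>
definition even_gauge :: "'v::real_vector set \<Rightarrow> 'v \<Rightarrow> ennreal" where
  "even_gauge C v = (minkowski_gauge C v + minkowski_gauge C (- v)) / 2"

lemma lagrangian_eq_gauge: "lagrangian \<Omega> (x, v) = minkowski_gauge (fibre \<Omega> x) v"
  by (simp add: lagrangian_def minkowski_gauge_def)

lemma minkowski_gauge_le: "0 < t \<Longrightarrow> inverse t *\<^sub>R v \<in> C \<Longrightarrow> minkowski_gauge C v \<le> ennreal t"
  unfolding minkowski_gauge_def by (intro Inf_lower CollectI exI[of _ t]) simp

lemma minkowski_gauge_zero:
  assumes "0 \<in> C"
  shows "minkowski_gauge C 0 = 0"
proof -
  have "minkowski_gauge C 0 \<le> 0"
  proof (rule ennreal_le_epsilon)
    show "minkowski_gauge C 0 \<le> 0 + ennreal e" if "0 < e" for e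
      using minkowski_gauge_le[of e 0 C] assms that by simp
  qed
  then show ?thesis by simp
qed

lemma minkowski_gauge_scaleR:
  assumes "0 < k"
  shows "minkowski_gauge C (k *\<^sub>R v) = ennreal k * minkowski_gauge C v"
proof -
  have ge: "ennreal k * minkowski_gauge C v \<le> minkowski_gauge C (k *\<^sub>R v)" if "0 < k" for k and v :: 'a
    unfolding minkowski_gauge_def[of C "k *\<^sub>R v"]
  proof (rule Inf_greatest, clarify)
    fix t :: real assume t: "0 < t" "inverse t *\<^sub>R k *\<^sub>R v \<in> C"
    then have "minkowski_gauge C v \<le> ennreal (t / k)"
      using that by (intro minkowski_gauge_le) (simp_all add: field_simps)
    then have "ennreal k * minkowski_gauge C v \<le> ennreal k * ennreal (t / k)"
      by (rule mult_left_mono) simp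
    also have "\<dots> = ennreal t"
      using that t by (simp add: ennreal_mult[symmetric])
    finally show "ennreal k * minkowski_gauge C v \<le> ennreal t" .
  qed
  have "minkowski_gauge C (k *\<^sub>R v)
      = ennreal k * (ennreal (inverse k) * minkowski_gauge C (k *\<^sub>R v))"
    using assms by (simp add: mult.assoc[symmetric] ennreal_mult[symmetric])
  also have "\<dots> \<le> ennreal k * minkowski_gauge C v"
    using ge[of "inverse k" "k *\<^sub>R v"] assms by (intro mult_left_mono) auto
  finally show ?thesis using ge[OF assms] by (simp add: antisym)
qed

text \<open>The supremum is the parameter at which the ray from 0 through \<open>v\<close> leaves \<open>C\<close>; if it never
  does, or leaves at once, the conventions for \<open>\<infinity>\<close> and 0 agree on both sides.\<close>

lemma enn2ereal_minkowski_gauge: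
  assumes "0 \<in> C"
  shows "enn2ereal (minkowski_gauge C v) = inverse (Sup (ereal ` {s. s *\<^sub>R v \<in> C}))"
    (is "?g = inverse ?S")
proof (rule antisym)
  have S0: "0 \<le> ?S"
    using assms by (intro Sup_upper2[of 0]) (auto simp: zero_ereal_def)
  have "?S \<le> inverse ?g"
  proof (rule Sup_least, clarify)
    fix s assume s: "s *\<^sub>R v \<in> C"
    show "ereal s \<le> inverse ?g"
    proof (cases "0 < s")
      case True
      then have "minkowski_gauge C v \<le> ennreal (inverse s)"
        using s by (intro minkowski_gauge_le) auto
      then have "?g \<le> ereal (inverse s)"
        using True by (simp add: less_eq_ennreal.rep_eq)
      then have "inverse (ereal (inverse s)) \<le> inverse ?g"
        by (intro ereal_inverse_antimono) auto
      then show ?thesis using True by simp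
    next
      case False
      then have "ereal s \<le> 0" by simp
      also have "0 \<le> inverse ?g" by (simp add: ereal_inverse_nonneg_iff)
      finally show ?thesis .
    qed
  qed
  from ereal_inverse_antimono[OF S0 this] show "?g \<le> inverse ?S"
    by (cases "minkowski_gauge C v" rule: ennreal_cases)
      (auto simp: zero_ereal_def[symmetric] split: if_splits)
  have "e2ennreal (inverse ?S) \<le> minkowski_gauge C v"
    unfolding minkowski_gauge_def
  proof (rule Inf_greatest, clarify)
    fix t :: real assume t: "0 < t" "inverse t *\<^sub>R v \<in> C"
    then have "ereal (inverse t) \<le> ?S"
      by (intro Sup_upper) auto
    then have "inverse ?S \<le> inverse (ereal (inverse t))"
      using t by (intro ereal_inverse_antimono) auto
    then have "inverse ?S \<le> ereal t" using t by simp
    then show "e2ennreal (inverse ?S) \<le> ennreal t"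
      using e2ennreal_mono[of "inverse ?S" "ereal t"] t by (simp add: e2ennreal_ereal)
  qed
  then show "inverse ?S \<le> ?g"
    using S0 by (simp add: less_eq_ennreal.rep_eq enn2ereal_e2ennreal ereal_inverse_nonneg_iff)
qed

text \<open>The harmonic mean of two distances is the inverse of the arithmetic mean of their inverses, and
  these inverses are the gauges of \<open>v\<close> and \<open>- v\<close>.\<close>

lemma harmonic_radius_eq:
  assumes "0 \<in> C"
  shows "harmonic_radius {s. s *\<^sub>R v \<in> C} 0 = inverse (enn2ereal (even_gauge C v))"
proof -
  let ?I = "{s. s *\<^sub>R v \<in> C}"
  have S0: "0 \<le> Sup (ereal ` ?I)"
    using assms by (intro Sup_upper2[of 0]) (auto simp: zero_ereal_def)
  have I0: "Inf (ereal ` ?I) \<le> 0"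
    using assms by (intro Inf_lower2[of 0]) (auto simp: zero_ereal_def)
  have "{s. s *\<^sub>R (- v) \<in> C} = uminus ` ?I"
    by (auto simp: image_iff intro!: exI[of _ "- s" for s])
  then have "ereal ` {s. s *\<^sub>R (- v) \<in> C} = uminus ` (ereal ` ?I)"
    by (simp add: image_image)
  then have "Sup (ereal ` {s. s *\<^sub>R (- v) \<in> C}) = - Inf (ereal ` ?I)"
    by (simp add: ereal_Sup_uminus_image_eq)
  then have "enn2ereal (minkowski_gauge C (- v)) = inverse \<bar>Inf (ereal ` ?I)\<bar>"
    using I0 by (cases "Inf (ereal ` ?I)") (simp_all add: enn2ereal_minkowski_gauge[OF assms])
  moreover have "enn2ereal (minkowski_gauge C v) = inverse \<bar>Sup (ereal ` ?I)\<bar>"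
    using S0 by (simp add: enn2ereal_minkowski_gauge[OF assms])
  moreover have "enn2ereal (a / 2) = enn2ereal a / 2" for a :: ennreal
    by (simp add: divide_ennreal_def divide_ereal_def times_ennreal.rep_eq inverse_ennreal.rep_eq)
  ultimately show ?thesis
    unfolding harmonic_radius_def even_gauge_def
    by (simp add: plus_ennreal.rep_eq add.commute zero_ereal_def[symmetric])
qed

text \<open>All cases in the definition of the symmetrized interval differ only at its end points, which a
  gauge does not see.\<close>

lemma harmonic_sym_interval_bounds:
  shows "ereal \<bar>s\<bar> < harmonic_radius I 0 \<Longrightarrow> s \<in> harmonic_sym_interval I 0"
    and "s \<in> harmonic_sym_interval I 0 \<Longrightarrow> ereal \<bar>s\<bar> \<le> harmonic_radius I 0"
  unfolding harmonic_sym_interval_def Let_def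
  by (cases "harmonic_radius I 0"; auto simp: zero_ereal_def split: if_splits)+

text \<open>Symmetrization upgrades positive homogeneity to homogeneity. This makes the choice of the
  vector \<open>v\<close> that spans a line irrelevant, and so allows the union defining \<open>harmonic_sym\<close> to be
  tested one vector at a time.\<close>

lemma even_gauge_scaleR:
  assumes "0 \<in> C"
  shows "even_gauge C (s *\<^sub>R v) = ennreal \<bar>s\<bar> * even_gauge C v"
proof -
  have "minkowski_gauge C (s *\<^sub>R v) + minkowski_gauge C (- (s *\<^sub>R v))
      = ennreal \<bar>s\<bar> * (minkowski_gauge C v + minkowski_gauge C (- v))"
  proof -
    consider "s = 0" | "0 < s" | "s < 0" by linarith
    then show ?thesis
    proof cases
      case 1 then show ?thesis by (simp add: minkowski_gauge_zero[OF assms])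
    next
      case 2 then show ?thesis
        using minkowski_gauge_scaleR[of s C v] minkowski_gauge_scaleR[of s C "- v"]
        by (simp add: distrib_left)
    next
      case 3 then show ?thesis
        using minkowski_gauge_scaleR[of "- s" C v] minkowski_gauge_scaleR[of "- s" C "- v"]
        by (simp add: distrib_left add.commute)
    qed
  qed
  then show ?thesis
    by (simp add: even_gauge_def ennreal_times_divide)
qed

lemma harmonic_sym_subset_ball:
  assumes "0 \<in> C" "w \<in> harmonic_sym V C 0"
  shows "even_gauge C w \<le> 1"
proof -
  from assms(2) obtain v s
    where w: "w = s *\<^sub>R v" and s: "s \<in> harmonic_sym_interval {s. s *\<^sub>R v \<in> C} 0"
    unfolding harmonic_sym_def add_0_left by (elim UN_E imageE) (rule that)
  have "ereal \<bar>s\<bar> \<le> inverse (enn2ereal (even_gauge C v))"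
    using harmonic_sym_interval_bounds(2)[OF s] by (simp only: harmonic_radius_eq[OF assms(1)])
  then have "ereal \<bar>s\<bar> * enn2ereal (even_gauge C v) \<le> 1"
    by (cases "even_gauge C v" rule: ennreal_cases)
      (auto simp: one_ereal_def field_simps split: if_splits)
  then have "ennreal \<bar>s\<bar> * even_gauge C v \<le> 1"
    by (simp only: less_eq_ennreal.rep_eq times_ennreal.rep_eq one_ennreal.rep_eq enn2ereal_ennreal abs_ge_zero)
  then show ?thesis by (simp add: w even_gauge_scaleR[OF assms(1)])
qed

lemma unit_ball_subset_harmonic_sym:
  assumes "0 \<in> C" "w \<in> V" "w \<noteq> 0" "even_gauge C w < 1"
  shows "w \<in> harmonic_sym V C 0"
proof -
  have "enn2ereal (even_gauge C w) < 1"
    using assms(4) unfolding less_ennreal.rep_eq one_ennreal.rep_eq .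
  then have "1 < inverse (enn2ereal (even_gauge C w))"
    by (cases "even_gauge C w" rule: ennreal_cases)
      (auto simp: one_ereal_def field_simps split: if_splits)
  then have "1 \<in> harmonic_sym_interval {s. s *\<^sub>R w \<in> C} 0"
    using harmonic_radius_eq[OF assms(1), of w]
    by (intro harmonic_sym_interval_bounds(1)) (simp add: one_ereal_def)
  then show ?thesis
    using assms(2,3) unfolding harmonic_sym_def add_0_left
    by (intro UN_I[of w] image_eqI[of _ _ 1]) simp_all
qed

text \<open>At the origin the comparison with the unit ball fails, because 0 spans no line.
  Any nonzero vector supplies a line whose symmetrized interval is centered at 0.\<close>

lemma zero_in_harmonic_sym:
  assumes "v \<in> V" "v \<noteq> 0"
  shows "0 \<in> harmonic_sym V C 0"
proof -
  have "0 \<in> harmonic_sym_interval I 0" for I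
  proof -
    have "0 \<le> harmonic_radius I 0"
      unfolding harmonic_radius_def
      by (simp add: ereal_inverse_nonneg_iff divide_ereal_def)
    then show ?thesis
      unfolding harmonic_sym_interval_def Let_def
      by (cases "harmonic_radius I 0") (auto simp: zero_ereal_def)
  qed
  then show ?thesis
    using assms unfolding harmonic_sym_def
    by (intro UN_I[of v] image_eqI[of _ _ 0]) simp_all
qed

text \<open>A set between the open and the closed unit ball of a homogeneous function has that function
  as its gauge.\<close>

theorem minkowski_gauge_harmonic_sym:
  assumes "subspace V" "V \<noteq> {0}" "0 \<in> C" "w \<in> V"
  shows "minkowski_gauge (harmonic_sym V C 0) w = even_gauge C w"
proof (cases "w = 0")
  case True
  obtain v where "v \<in> V" "v \<noteq> 0"
    using assms(1,2) subspace_0 by fastforce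
  then show ?thesis
    using assms(3) zero_in_harmonic_sym[of v V C] True
    by (simp add: even_gauge_def minkowski_gauge_zero)
next
  case False
  have gt: "ennreal (inverse t) * even_gauge C w = even_gauge C (inverse t *\<^sub>R w)" if "0 < t" for t
    using even_gauge_scaleR[OF assms(3), of "inverse t" w] that by simp
  show ?thesis
  proof (rule antisym)
    show "even_gauge C w \<le> minkowski_gauge (harmonic_sym V C 0) w"
      unfolding minkowski_gauge_def
    proof (rule Inf_greatest, clarify)
      fix t :: real assume t: "0 < t" "inverse t *\<^sub>R w \<in> harmonic_sym V C 0"
      have "even_gauge C w = ennreal t * even_gauge C (inverse t *\<^sub>R w)"
        using gt[OF t(1)] t(1) by (simp add: gt[symmetric] mult.assoc[symmetric] ennreal_mult[symmetric])
      also have "\<dots> \<le> ennreal t * 1"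
        by (intro mult_left_mono harmonic_sym_subset_ball[OF assms(3) t(2)]) simp
      finally show "even_gauge C w \<le> ennreal t" by simp
    qed
    \<comment> \<open>Only the open unit ball is known to lie in the symmetrization, so the bound is obtained
      for all larger values instead of \<open>N w\<close> itself.\<close>
    show "minkowski_gauge (harmonic_sym V C 0) w \<le> even_gauge C w"
    proof (rule dense_ge)
      fix y assume y: "even_gauge C w < y"
      show "minkowski_gauge (harmonic_sym V C 0) w \<le> y"
      proof (cases y rule: ennreal_cases)
        case (real t)
        with y have t: "0 < t" by (cases "t = 0") auto
        have "ennreal (inverse t) * even_gauge C w < ennreal (inverse t) * ennreal t"
          using y real t by (intro ennreal_mult_strict_left_mono) auto
        then have "even_gauge C (inverse t *\<^sub>R w) < 1"
          using t by (simp add: gt ennreal_mult[symmetric])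
        then have "inverse t *\<^sub>R w \<in> harmonic_sym V C 0"
          using assms False t by (intro unit_ball_subset_harmonic_sym) (auto simp: subspace_scale)
        then show ?thesis using minkowski_gauge_le t real by metis
      qed simp
    qed
  qed
qed

section \<open>Tangent spaces\<close>

lemma is_chart_inj: "is_chart M c \<Longrightarrow> inj_on (snd c) (fst c)"
  unfolding is_chart_def
  by (metis homeomorphic_imp_injective_map openin_subset topspace_subtopology_subset)

lemma is_chart_open_image:
  assumes "is_chart M c" "openin M U" "U \<subseteq> fst c"
  shows "open (snd c ` U)"
proof -
  have "open_map (subtopology M (fst c)) (top_of_set (snd c ` fst c)) (snd c)"
    using assms(1) unfolding is_chart_def by (blast intro: homeomorphic_imp_open_map)
  moreover have "openin (subtopology M (fst c)) U"
    using assms(2,3) by (metis inf.absorb_iff1 openin_subtopology)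
  ultimately have "openin (top_of_set (snd c ` fst c)) (snd c ` U)"
    unfolding open_map_def by blast
  then show ?thesis
    using assms(1) unfolding is_chart_def by (meson openin_open_trans)
qed

lemma transition_apply:
  "is_chart M c \<Longrightarrow> x \<in> fst c \<Longrightarrow> transition c c' (snd c x) = snd c' x"
  by (simp add: transition_def inv_into_f_f is_chart_inj)

lemma transition_has_derivative:
  assumes "C1_manifold M A" "c \<in> charts_at A x" "c' \<in> charts_at A x"
  shows "(transition c c' has_derivative frechet_derivative (transition c c') (at (snd c x)))
           (at (snd c x))"
proof -
  have "C1_on (snd c ` (fst c \<inter> fst c')) (transition c c')" "snd c x \<in> snd c ` (fst c \<inter> fst c')"
    using assms by (auto simp: C1_manifold_def charts_at_def)
  then have "transition c c' differentiable (at (snd c x))"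
    unfolding C1_on_def differentiable_def by blast
  then show ?thesis by (simp add: frechet_derivative_works)
qed

text \<open>This is the chain rule for the identity
  \<open>transition c c'' = transition c' c'' \<circ> transition c c'\<close>, which is valid only on the
  image of the common domain of the three charts, an open set.\<close>

lemma transition_cocycle:
  assumes M: "C1_manifold M A"
    and c: "c \<in> charts_at A x" "c' \<in> charts_at A x" "c'' \<in> charts_at A x"
  shows "frechet_derivative (transition c c'') (at (snd c x)) e =
    frechet_derivative (transition c' c'') (at (snd c' x))
      (frechet_derivative (transition c c') (at (snd c x)) e)"
proof -
  have ch: "is_chart M c" "is_chart M c'" "is_chart M c''"
    and x: "x \<in> fst c" "x \<in> fst c'" "x \<in> fst c''"
    using M c by (auto simp: C1_manifold_def charts_at_def)
  let ?U = "fst c \<inter> fst c' \<inter> fst c''"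
  have "openin M ?U" using ch by (auto simp: is_chart_def)
  then have op: "open (snd c ` ?U)" by (intro is_chart_open_image[OF ch(1)]) auto
  have "(transition c' c'' \<circ> transition c c' has_derivative
      frechet_derivative (transition c' c'') (at (snd c' x)) \<circ>
      frechet_derivative (transition c c') (at (snd c x))) (at (snd c x))"
    using transition_has_derivative[OF M c(1,2)] transition_has_derivative[OF M c(2,3)]
    by (intro diff_chain_at) (simp_all add: transition_apply[OF ch(1) x(1)])
  then have "(transition c c'' has_derivative
      frechet_derivative (transition c' c'') (at (snd c' x)) \<circ>
      frechet_derivative (transition c c') (at (snd c x))) (at (snd c x))"
  proof (rule has_derivative_transform_within_open[OF _ op])
    show "snd c x \<in> snd c ` ?U" using x by blast
  qed (auto simp: transition_apply[OF ch(1)] transition_apply[OF ch(2)])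
  from has_derivative_unique[OF this transition_has_derivative[OF M c(1,3)]]
  show ?thesis by (metis comp_apply)
qed

lemma transition_self_derivative:
  assumes M: "C1_manifold M A" and c: "c \<in> charts_at A x"
  shows "frechet_derivative (transition c c) (at (snd c x)) e = e"
proof -
  have ch: "is_chart M c" and x: "x \<in> fst c"
    using M c by (auto simp: C1_manifold_def charts_at_def)
  have "(transition c c has_derivative (\<lambda>h. h)) (at (snd c x))"
  proof (rule has_derivative_transform_within_open[OF has_derivative_ident])
    show "open (snd c ` fst c)" using ch by (simp add: is_chart_def)
    show "snd c x \<in> snd c ` fst c" using x by blast
  qed (auto simp: transition_apply[OF ch])
  from has_derivative_unique[OF this transition_has_derivative[OF M c c]]
  show ?thesis by metis
qed

lemma tangent_spaceI:
  assumes "\<And>c. c \<notin> charts_at A x \<Longrightarrow> v c = 0"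
    and "\<And>c c'. c \<in> charts_at A x \<Longrightarrow> c' \<in> charts_at A x \<Longrightarrow>
      v c' = frechet_derivative (transition c c') (at (snd c x)) (v c)"
  shows "v \<in> tangent_space A x"
  using assms unfolding tangent_space_def by blast

lemma tangent_spaceD:
  assumes "v \<in> tangent_space A x"
  shows "c \<notin> charts_at A x \<Longrightarrow> v c = 0"
    and "c \<in> charts_at A x \<Longrightarrow> c' \<in> charts_at A x \<Longrightarrow>
      v c' = frechet_derivative (transition c c') (at (snd c x)) (v c)"
  using assms unfolding tangent_space_def by blast+

lemma subspace_tangent_space:
  assumes M: "C1_manifold M A"
  shows "subspace (tangent_space A x)"
proof -
  have lin: "linear (frechet_derivative (transition c c') (at (snd c x)))"
    if "c \<in> charts_at A x" "c' \<in> charts_at A x" for c c'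
    using transition_has_derivative[OF M that] has_derivative_linear by blast
  show ?thesis
  proof (rule subspaceI)
    show "0 \<in> tangent_space A x"
      by (rule tangent_spaceI) (simp_all only: zero_fun_apply linear_0[OF lin])
    show "v + w \<in> tangent_space A x" if v: "v \<in> tangent_space A x" and w: "w \<in> tangent_space A x" for v w
    proof (rule tangent_spaceI)
      show "(v + w) c = 0" if "c \<notin> charts_at A x" for c
        by (simp add: tangent_spaceD(1)[OF v that] tangent_spaceD(1)[OF w that])
      show "(v + w) c' = frechet_derivative (transition c c') (at (snd c x)) ((v + w) c)"
        if c: "c \<in> charts_at A x" "c' \<in> charts_at A x" for c c'
        unfolding plus_fun_apply linear_add[OF lin[OF c]]
          tangent_spaceD(2)[OF v c] tangent_spaceD(2)[OF w c] ..
    qed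
    show "k *\<^sub>R v \<in> tangent_space A x" if v: "v \<in> tangent_space A x" for k v
    proof (rule tangent_spaceI)
      show "(k *\<^sub>R v) c = 0" if "c \<notin> charts_at A x" for c
        by (simp add: scaleR_fun_def tangent_spaceD(1)[OF v that])
      show "(k *\<^sub>R v) c' = frechet_derivative (transition c c') (at (snd c x)) ((k *\<^sub>R v) c)"
        if c: "c \<in> charts_at A x" "c' \<in> charts_at A x" for c c'
        unfolding scaleR_fun_def linear_cmul[OF lin[OF c]] tangent_spaceD(2)[OF v c] ..
    qed
  qed
qed

text \<open>Transporting a nonzero coordinate vector from one chart to all the others gives a family that
  is compatible by the cocycle rule.\<close>

lemma tangent_space_nontrivial:
  fixes A :: "('a, 'e::euclidean_space) chart set"
  assumes M: "C1_manifold M A" and "x \<in> topspace M"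
  shows "tangent_space A x \<noteq> {0}"
proof -
  have "x \<in> (\<Union>c\<in>A. fst c)"
    using assms unfolding C1_manifold_def by simp
  then obtain c where c: "c \<in> charts_at A x"
    unfolding charts_at_def by blast
  obtain e :: 'e where e: "e \<noteq> 0"
    using nonzero_Basis[OF SOME_Basis] by (rule that)
  define v where "v c' = (if c' \<in> charts_at A x
    then frechet_derivative (transition c c') (at (snd c x)) e else 0)" for c'
  have "v \<in> tangent_space A x"
  proof (rule tangent_spaceI)
    show "v c'' = frechet_derivative (transition c' c'') (at (snd c' x)) (v c')"
      if "c' \<in> charts_at A x" "c'' \<in> charts_at A x" for c' c''
      using transition_cocycle[OF M c that] that unfolding v_def by simp
  qed (simp add: v_def)
  moreover have "v c = e"
    by (simp add: v_def c transition_self_derivative[OF M c])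
  then have "v \<noteq> 0"
    using e zero_fun_apply by metis
  ultimately show ?thesis by blast
qed

text \<open>The pointwise form of the first assertion of the theorem.\<close>

theorem lagrangian_harmonic_sym_structure:
  assumes "C1_manifold M A" "weak_Finsler_structure M A \<Omega>" "(x, v) \<in> tangent_bundle M A"
  shows "lagrangian (harmonic_sym_structure M A \<Omega>) (x, v) =
    (lagrangian \<Omega> (x, v) + lagrangian \<Omega> (x, - v)) / 2"
proof -
  have x: "x \<in> topspace M" "v \<in> tangent_space A x"
    using assms(3) by (auto simp: tangent_bundle_def)
  then have "fibre (harmonic_sym_structure M A \<Omega>) x = harmonic_sym (tangent_space A x) (fibre \<Omega> x) 0"
    unfolding harmonic_sym_structure_def fibre_def[of "Sigma _ _"] by simp
  moreover have "0 \<in> fibre \<Omega> x"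
    using assms(2) x by (simp add: weak_Finsler_structure_def)
  ultimately show ?thesis
    using minkowski_gauge_harmonic_sym[OF subspace_tangent_space[OF assms(1)]
        tangent_space_nontrivial[OF assms(1) x(1)] _ x(2)]
    by (simp add: lagrangian_eq_gauge even_gauge_def)
qed

section \<open>The velocity of a piecewise \<open>C\<^sup>1\<close> path\<close>

text \<open>An open set \<open>U\<close> of times, cofinite in the parameter interval, at which the velocity is a genuine
  two-sided derivative and continuous in each chart. Openness of the sets of times spent in chart
  domains is how continuity of \<open>\<gamma>\<close> is recorded: the points of the manifold form a type without
  a topology of its own, so that continuity at a point is not a filter limit.\<close>
definition regular_times ::
  "'a topology \<Rightarrow> ('a, 'e::euclidean_space) chart set \<Rightarrow> real \<Rightarrow> real \<Rightarrow> (real \<Rightarrow> 'a) \<Rightarrow> real set \<Rightarrow> bool" where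
  "regular_times M A a b \<gamma> U \<longleftrightarrow> open U \<and> U \<subseteq> {a..b} \<and> finite ({a..b} - U) \<and>
     (\<forall>c\<in>A. open {t\<in>U. \<gamma> t \<in> fst c}) \<and>
     (\<forall>c\<in>A. \<forall>t\<in>U. \<gamma> t \<in> fst c \<longrightarrow>
        (snd c \<circ> \<gamma> has_vector_derivative velocity A a b \<gamma> t c) (at t) \<and>
        isCont (\<lambda>t. velocity A a b \<gamma> t c) t)"

text \<open>Inside a piece of the path, the one-sided derivative within the piece, the derivative and the
  derivative within the whole parameter interval coincide. The neighbourhood \<open>V\<close> is what makes the
  times spent in a chart domain an open set.\<close>

lemma C1_path_derivative_interior:
  assumes "C1_path M A p q \<gamma>" "c \<in> A" "t \<in> {p<..<q}" "\<gamma> t \<in> fst c"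
    "{p..q} \<subseteq> {a..b}" "openin M (fst c)"
  shows "(snd c \<circ> \<gamma> has_vector_derivative velocity A a b \<gamma> t c) (at t) \<and>
    isCont (\<lambda>t. velocity A a b \<gamma> t c) t \<and> (\<exists>V. open V \<and> t \<in> V \<and> V \<subseteq> {p<..<q} \<and> \<gamma> ` V \<subseteq> fst c)"
proof -
  obtain D where D: "\<And>s. s \<in> {p..q} \<Longrightarrow> \<gamma> s \<in> fst c \<Longrightarrow>
      (snd c \<circ> \<gamma> has_vector_derivative D s) (at s within {p..q})"
    and contD: "continuous_on {s\<in>{p..q}. \<gamma> s \<in> fst c} D"
    using assms(1,2) unfolding C1_path_def by blast
  have "openin (top_of_set {p..q}) {s\<in>{p..q}. \<gamma> s \<in> fst c}"
    using assms(1,6) openin_continuous_map_preimage[of "top_of_set {p..q}" M \<gamma> "fst c"]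
    unfolding C1_path_def by simp
  then obtain S where S: "open S" "{s\<in>{p..q}. \<gamma> s \<in> fst c} = {p..q} \<inter> S"
    by (auto simp: openin_open)
  define V where "V = {p<..<q} \<inter> S"
  have S_iff: "s \<in> S \<longleftrightarrow> \<gamma> s \<in> fst c" if "s \<in> {p..q}" for s
    using S(2) that by blast
  have V: "open V" "t \<in> V" "V \<subseteq> {p<..<q}" "\<gamma> ` V \<subseteq> fst c"
    using S(1) assms(3,4) by (auto simp: V_def S_iff)
  have der: "(snd c \<circ> \<gamma> has_vector_derivative D s) (at s)" if "s \<in> V" for s
  proof -
    have s: "s \<in> {p<..<q}" "\<gamma> s \<in> fst c" using that V by auto
    then show ?thesis
      using D[of s] at_within_Icc_at[of p s q] by simp
  qed
  have vel: "velocity A a b \<gamma> s c = D s" if "s \<in> V" for s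
  proof -
    have "\<gamma> s \<in> fst c" "a \<le> s" "s \<le> b" "a < b" using that V assms(5) by fastforce+
    then show ?thesis
      using vector_derivative_at_within_ivl[OF der[OF that]] assms(2)
      by (simp add: velocity_def charts_at_def)
  qed
  have "continuous_on V D"
    using contD by (rule continuous_on_subset) (use V in auto)
  then have "continuous_on V (\<lambda>t. velocity A a b \<gamma> t c)"
    using vel by (simp cong: continuous_on_cong)
  then show ?thesis
    using der[OF V(2)] vel[OF V(2)] V continuous_on_eq_continuous_at[OF V(1)] by auto
qed

lemma partition_mono:
  fixes \<tau> :: "nat \<Rightarrow> real"
  assumes "\<forall>i<n. \<tau> i < \<tau> (Suc i)" "i \<le> j" "j \<le> n"
  shows "\<tau> i \<le> \<tau> j"
  using assms(2,3)
proof (induction rule: dec_induct)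
  case (step k)
  then show ?case using assms(1) by (meson Suc_le_lessD less_imp_le order_trans)
qed simp

lemma partition_covers:
  fixes \<tau> :: "nat \<Rightarrow> real"
  assumes "\<tau> 0 \<le> t" "t \<le> \<tau> n"
  shows "t \<in> \<tau> ` {..n} \<or> (\<exists>i<n. t \<in> {\<tau> i<..<\<tau> (Suc i)})"
  using assms(2)
proof (induction n)
  case 0
  then show ?case using assms(1) by auto
next
  case (Suc n)
  show ?case
  proof (cases "t \<le> \<tau> n")
    case True
    then show ?thesis using Suc.IH by (auto simp: less_Suc_eq)
  next
    case False
    then show ?thesis using Suc.prems by (cases "t = \<tau> (Suc n)") (auto intro!: exI[of _ n])
  qed
qed

lemma piecewise_C1_path_regular_times:
  assumes M: "C1_manifold M A" and "piecewise_C1_path M A a b \<gamma>"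
  obtains U where "regular_times M A a b \<gamma> U"
proof -
  obtain n :: nat and \<tau> where \<tau>: "\<tau> 0 = a" "\<tau> n = b" "\<forall>i<n. \<tau> i < \<tau> (Suc i)"
    and C1: "\<And>i. i < n \<Longrightarrow> C1_path M A (\<tau> i) (\<tau> (Suc i)) \<gamma>"
    using assms(2) unfolding piecewise_C1_path_def by blast
  define U where "U = (\<Union>i<n. {\<tau> i<..<\<tau> (Suc i)})"
  have sub: "{\<tau> i..\<tau> (Suc i)} \<subseteq> {a..b}" if "i < n" for i
    using partition_mono[OF \<tau>(3), of 0 i] partition_mono[OF \<tau>(3), of "Suc i" n] that \<tau>(1,2) by auto
  have loc: "(snd c \<circ> \<gamma> has_vector_derivative velocity A a b \<gamma> t c) (at t) \<and>
      isCont (\<lambda>t. velocity A a b \<gamma> t c) t \<and> (\<exists>V. open V \<and> t \<in> V \<and> V \<subseteq> U \<and> \<gamma> ` V \<subseteq> fst c)"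
    if "c \<in> A" "t \<in> U" "\<gamma> t \<in> fst c" for c t
  proof -
    obtain i where i: "i < n" "t \<in> {\<tau> i<..<\<tau> (Suc i)}" using \<open>t \<in> U\<close> by (auto simp: U_def)
    have "openin M (fst c)" using M \<open>c \<in> A\<close> by (auto simp: C1_manifold_def is_chart_def)
    moreover have "{\<tau> i<..<\<tau> (Suc i)} \<subseteq> U" using i by (auto simp: U_def)
    ultimately show ?thesis
      using C1_path_derivative_interior[OF C1[OF i(1)] that(1) i(2) that(3) sub[OF i(1)]]
      by (meson order_trans)
  qed
  have "open U" by (auto simp: U_def)
  moreover have "U \<subseteq> {a..b}"
    unfolding U_def using sub greaterThanLessThan_subseteq_atLeastAtMost_iff by fastforce
  moreover have "{a..b} - U \<subseteq> \<tau> ` {..n}"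
  proof
    fix t assume "t \<in> {a..b} - U"
    then show "t \<in> \<tau> ` {..n}"
      using partition_covers[of \<tau> t n] \<tau>(1,2) unfolding U_def by auto
  qed
  then have "finite ({a..b} - U)" by (rule finite_subset) simp
  moreover have "open {t\<in>U. \<gamma> t \<in> fst c}" if c: "c \<in> A" for c
    unfolding open_subopen[of "{t\<in>U. \<gamma> t \<in> fst c}"]
  proof
    fix t assume "t \<in> {t\<in>U. \<gamma> t \<in> fst c}"
    then obtain V where "open V" "t \<in> V" "V \<subseteq> U" "\<gamma> ` V \<subseteq> fst c"
      using loc[OF c, of t] by auto
    then show "\<exists>V. open V \<and> t \<in> V \<and> V \<subseteq> {t\<in>U. \<gamma> t \<in> fst c}"
      by (intro exI[of _ V]) auto
  qed
  ultimately have "regular_times M A a b \<gamma> U"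
    unfolding regular_times_def using loc by blast
  then show ?thesis by (rule that)
qed

text \<open>The chain rule for \<open>snd c' \<circ> \<gamma> = transition c c' \<circ> (snd c \<circ> \<gamma>)\<close>, which holds while \<open>\<gamma>\<close> stays in
  both chart domains.\<close>

lemma velocity_in_tangent_space:
  assumes M: "C1_manifold M A" and U: "regular_times M A a b \<gamma> U" and t: "t \<in> U"
  shows "velocity A a b \<gamma> t \<in> tangent_space A (\<gamma> t)"
proof (rule tangent_spaceI)
  show "velocity A a b \<gamma> t c = 0" if "c \<notin> charts_at A (\<gamma> t)" for c
    using that by (simp add: velocity_def)
next
  fix c c' assume c: "c \<in> charts_at A (\<gamma> t)" "c' \<in> charts_at A (\<gamma> t)"
  let ?F = "frechet_derivative (transition c c') (at (snd c (\<gamma> t)))"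
  let ?v = "velocity A a b \<gamma> t"
  have cA: "c \<in> A" "\<gamma> t \<in> fst c" "c' \<in> A" "\<gamma> t \<in> fst c'"
    using c by (auto simp: charts_at_def)
  have ch: "is_chart M c" using M cA(1) by (simp add: C1_manifold_def)
  have der: "(snd c \<circ> \<gamma> has_derivative (\<lambda>h. h *\<^sub>R ?v c)) (at t)"
    "(snd c' \<circ> \<gamma> has_derivative (\<lambda>h. h *\<^sub>R ?v c')) (at t)"
    using U t cA unfolding regular_times_def has_vector_derivative_def by blast+
  have "(transition c c' \<circ> (snd c \<circ> \<gamma>) has_derivative ?F \<circ> (\<lambda>h. h *\<^sub>R ?v c)) (at t)"
    by (rule diff_chain_at[OF der(1)]) (use transition_has_derivative[OF M c] in simp)
  moreover have "open ({s\<in>U. \<gamma> s \<in> fst c} \<inter> {s\<in>U. \<gamma> s \<in> fst c'})"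
    using U cA unfolding regular_times_def by blast
  ultimately have "(snd c' \<circ> \<gamma> has_derivative ?F \<circ> (\<lambda>h. h *\<^sub>R ?v c)) (at t)"
    by (rule has_derivative_transform_within_open) (use t cA transition_apply[OF ch] in auto)
  from has_derivative_unique[OF this der(2)] have "(?F \<circ> (\<lambda>h. h *\<^sub>R ?v c)) 1 = 1 *\<^sub>R ?v c'"
    by (rule fun_cong)
  then show "?v c' = ?F (?v c)" by simp
qed

text \<open>The factor \<open>r\<close> is there to treat the velocities of the path and of its reverse,
  \<open>r = 1\<close> and \<open>r = - 1\<close>, at once.\<close>

lemma lift_in_tangent_bundle:
  assumes M: "C1_manifold M A" and "piecewise_C1_path M A a b \<gamma>"
    and U: "regular_times M A a b \<gamma> U" and t: "t \<in> U"
  shows "(\<gamma> t, r *\<^sub>R velocity A a b \<gamma> t) \<in> tangent_bundle M A"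
proof -
  have "t \<in> {a..b}" using U t unfolding regular_times_def by blast
  moreover have "\<gamma> ` {a..b} \<subseteq> topspace M"
    using assms(2) continuous_map_image_subset_topspace[of "top_of_set {a..b}" M \<gamma>]
    unfolding piecewise_C1_path_def by simp
  ultimately have "\<gamma> t \<in> topspace M" by blast
  then show ?thesis
    using subspace_scale[OF subspace_tangent_space[OF M] velocity_in_tangent_space[OF M U t]]
    by (simp add: tangent_bundle_def)
qed

text \<open>For the topology generated by the bundle charts it suffices to look at one chart at a time, and
  there the lift is continuous by the choice of \<open>U\<close>.\<close>

lemma lift_continuous:
  assumes M: "C1_manifold M A" and \<gamma>: "piecewise_C1_path M A a b \<gamma>"
    and U: "regular_times M A a b \<gamma> U"
  shows "continuous_map (top_of_set U) (tangent_bundle_topology M A)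
    (\<lambda>t. (\<gamma> t, r *\<^sub>R velocity A a b \<gamma> t))"
  unfolding tangent_bundle_topology_def
proof (rule continuous_on_generated_topo)
  let ?L = "\<lambda>t. (\<gamma> t, r *\<^sub>R velocity A a b \<gamma> t)"
  fix S assume "S \<in> {{(x, v) \<in> tangent_bundle M A. x \<in> fst c \<and> (snd c x, v c) \<in> W} | c W. c \<in> A \<and> open W}"
  then obtain c W where S: "S = {(x, v) \<in> tangent_bundle M A. x \<in> fst c \<and> (snd c x, v c) \<in> W}"
    and c: "c \<in> A" and W: "open W" by blast
  let ?g = "\<lambda>t. ((snd c \<circ> \<gamma>) t, r *\<^sub>R velocity A a b \<gamma> t c)"
  let ?T = "{t\<in>U. \<gamma> t \<in> fst c}"
  have T: "open ?T" using U c unfolding regular_times_def by blast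
  have "isCont ?g t" if "t \<in> ?T" for t
  proof -
    have "(snd c \<circ> \<gamma> has_vector_derivative velocity A a b \<gamma> t c) (at t)"
      "isCont (\<lambda>t. velocity A a b \<gamma> t c) t"
      using U c that unfolding regular_times_def by blast+
    then show ?thesis
      by (intro continuous_Pair continuous_scaleR continuous_const)
        (rule has_vector_derivative_continuous)
  qed
  then have "continuous_on ?T ?g"
    by (intro continuous_at_imp_continuous_on) blast
  then have "open (?T \<inter> ?g -` W)"
    using T W by (rule continuous_open_preimage)
  moreover have "?L -` S \<inter> topspace (top_of_set U) = ?T \<inter> ?g -` W"
    using lift_in_tangent_bundle[OF M \<gamma> U, of _ r] by (auto simp: S scaleR_fun_def)
  ultimately show "openin (top_of_set U) (?L -` S \<inter> topspace (top_of_set U))"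
    by (auto intro: open_subset)
next
  show "(\<lambda>t. (\<gamma> t, r *\<^sub>R velocity A a b \<gamma> t)) ` topspace (top_of_set U) \<subseteq>
    \<Union>{{(x, v) \<in> tangent_bundle M A. x \<in> fst c \<and> (snd c x, v c) \<in> W} | c W. c \<in> A \<and> open W}"
  proof clarify
    fix t assume "t \<in> topspace (top_of_set U)"
    then have L: "(\<gamma> t, r *\<^sub>R velocity A a b \<gamma> t) \<in> tangent_bundle M A"
      using lift_in_tangent_bundle[OF M \<gamma> U] by simp
    then have "\<gamma> t \<in> (\<Union>c\<in>A. fst c)"
      using M unfolding tangent_bundle_def C1_manifold_def by simp
    then obtain c where c: "c \<in> A" "\<gamma> t \<in> fst c" by blast
    show "(\<gamma> t, r *\<^sub>R velocity A a b \<gamma> t) \<in>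
      \<Union>{{(x, v) \<in> tangent_bundle M A. x \<in> fst c \<and> (snd c x, v c) \<in> W} | c W. c \<in> A \<and> open W}"
    proof (rule UnionI)
      show "{(x, v) \<in> tangent_bundle M A. x \<in> fst c \<and> (snd c x, v c) \<in> UNIV} \<in>
        {{(x, v) \<in> tangent_bundle M A. x \<in> fst c \<and> (snd c x, v c) \<in> W} | c W. c \<in> A \<and> open W}"
        using c(1) by blast
    qed (use L c(2) in simp)
  qed
qed

lemma lift_measurable:
  assumes M: "C1_manifold M A" and \<gamma>: "piecewise_C1_path M A a b \<gamma>"
    and U: "regular_times M A a b \<gamma> U"
  shows "(\<lambda>t. (\<gamma> t, r *\<^sub>R velocity A a b \<gamma> t)) \<in>
    measurable (restrict_space borel U) (tangent_bundle_borel M A)"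
  unfolding tangent_bundle_borel_def
proof (rule measurable_measure_of)
  let ?L = "\<lambda>t. (\<gamma> t, r *\<^sub>R velocity A a b \<gamma> t)"
  have top: "topspace (tangent_bundle_topology M A) \<subseteq> tangent_bundle M A"
    unfolding tangent_bundle_topology_def topology_generated_by_topspace by blast
  show "{W. openin (tangent_bundle_topology M A) W} \<subseteq> Pow (tangent_bundle M A)"
    using top openin_subset by blast
  show "?L \<in> space (restrict_space borel U) \<rightarrow> tangent_bundle M A"
    using lift_in_tangent_bundle[OF M \<gamma> U] by (simp add: space_restrict_space)
  fix W assume "W \<in> {W. openin (tangent_bundle_topology M A) W}"
  then have "openin (top_of_set U) {t \<in> topspace (top_of_set U). ?L t \<in> W}"
    using openin_continuous_map_preimage[OF lift_continuous[OF M \<gamma> U]] by blast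
  moreover have "open U" using U by (simp add: regular_times_def)
  ultimately have "open {t\<in>U. ?L t \<in> W}"
    using openin_open_trans by fastforce
  moreover have "?L -` W \<inter> space (restrict_space borel U) = {t\<in>U. ?L t \<in> W}"
    by (auto simp: space_restrict_space)
  ultimately show "?L -` W \<inter> space (restrict_space borel U) \<in> sets (restrict_space borel U)"
    using \<open>open U\<close> by (auto simp: sets_restrict_space_iff)
qed

text \<open>Discards the break points, at which the velocity is unspecified and the integrand therefore
  out of control.\<close>

lemma nn_integral_cofinite_subset:
  fixes f g :: "real \<Rightarrow> ennreal"
  assumes "U \<subseteq> {a..b}" "finite ({a..b} - U)" "\<And>t. t \<in> U \<Longrightarrow> f t = g t"
  shows "(\<integral>\<^sup>+t\<in>{a..b}. f t \<partial>lborel) = (\<integral>\<^sup>+t. g t * indicator U t \<partial>lborel)"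
proof (rule nn_integral_cong_AE)
  have "AE t in lborel. t \<notin> {a..b} - U"
    using assms(2) by (intro AE_not_in finite_imp_null_set_lborel)
  then show "AE t in lborel. f t * indicator {a..b} t = g t * indicator U t"
    by eventually_elim (use assms(1,3) in \<open>auto simp: indicator_def\<close>)
qed

section \<open>Reversal of paths\<close>

lemma velocity_reverse_path:
  assumes "regular_times M A a b \<gamma> U" "a < b" "a + b - t \<in> U"
  shows "velocity A a b (reverse_path a b \<gamma>) t = - velocity A a b \<gamma> (a + b - t)"
proof
  fix c
  show "velocity A a b (reverse_path a b \<gamma>) t c = (- velocity A a b \<gamma> (a + b - t)) c"
  proof (cases "c \<in> charts_at A (\<gamma> (a + b - t))")
    case True
    then have "(snd c \<circ> \<gamma> has_vector_derivative velocity A a b \<gamma> (a + b - t) c) (at (a + b - t))"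
      using assms(1,3) unfolding regular_times_def charts_at_def by blast
    moreover have "((\<lambda>t. a + b - t) has_vector_derivative - 1) (at t)"
      by (auto intro!: derivative_eq_intros)
    ultimately have "((snd c \<circ> \<gamma>) \<circ> (\<lambda>t. a + b - t) has_vector_derivative
        (- 1) *\<^sub>R velocity A a b \<gamma> (a + b - t) c) (at t)"
      by (intro vector_diff_chain_at)
    then have "(snd c \<circ> reverse_path a b \<gamma> has_vector_derivative
        - velocity A a b \<gamma> (a + b - t) c) (at t)"
      by (simp add: reverse_path_def comp_def)
    moreover have "a + b - t \<in> {a..b}" using assms(1,3) unfolding regular_times_def by blast
    ultimately have "vector_derivative (snd c \<circ> reverse_path a b \<gamma>) (at t within {a..b}) =
        - velocity A a b \<gamma> (a + b - t) c"
      using assms(2) by (intro vector_derivative_at_within_ivl) auto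
    then show ?thesis
      using True by (simp add: velocity_def[of A a b "reverse_path a b \<gamma>"]) (simp add: reverse_path_def)
  next
    case False
    then show ?thesis by (simp add: velocity_def reverse_path_def)
  qed
qed

lemma C1_path_reverse:
  assumes "C1_path M A p q \<gamma>"
  shows "C1_path M A (s - q) (s - p) (\<lambda>t. \<gamma> (s - t))"
  unfolding C1_path_def
proof (intro conjI ballI)
  have im: "(\<lambda>t. s - t) ` {s - q..s - p} = {p..q}"
    by (auto intro!: image_eqI[of _ _ "s - x" for x])
  have cont: "continuous_on T (\<lambda>t. s - t)" for T
    by (intro continuous_intros)
  have "continuous_map (top_of_set {s - q..s - p}) (top_of_set {p..q}) (\<lambda>t. s - t)"
    using cont im by auto
  then have "continuous_map (top_of_set {s - q..s - p}) M (\<gamma> \<circ> (\<lambda>t. s - t))"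
    using assms unfolding C1_path_def by (blast intro: continuous_map_compose)
  then show "continuous_map (top_of_set {s - q..s - p}) M (\<lambda>t. \<gamma> (s - t))"
    by (simp add: comp_def)
  fix c assume "c \<in> A"
  then obtain D where D: "\<And>t. t \<in> {p..q} \<Longrightarrow> \<gamma> t \<in> fst c \<Longrightarrow>
      (snd c \<circ> \<gamma> has_vector_derivative D t) (at t within {p..q})"
    and contD: "continuous_on {t\<in>{p..q}. \<gamma> t \<in> fst c} D"
    using assms unfolding C1_path_def by blast
  show "\<exists>D. (\<forall>t\<in>{t\<in>{s - q..s - p}. \<gamma> (s - t) \<in> fst c}.
        (snd c \<circ> (\<lambda>t. \<gamma> (s - t)) has_vector_derivative D t) (at t within {s - q..s - p})) \<and>
      continuous_on {t\<in>{s - q..s - p}. \<gamma> (s - t) \<in> fst c} D"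
  proof (intro exI[of _ "\<lambda>t. - D (s - t)"] conjI ballI)
    fix t assume t: "t \<in> {t\<in>{s - q..s - p}. \<gamma> (s - t) \<in> fst c}"
    have "((\<lambda>t. s - t) has_vector_derivative - 1) (at t within {s - q..s - p})"
      by (auto intro!: derivative_eq_intros)
    moreover have "(snd c \<circ> \<gamma> has_vector_derivative D (s - t))
        (at (s - t) within (\<lambda>t. s - t) ` {s - q..s - p})"
      unfolding im using t by (intro D) auto
    ultimately have "((snd c \<circ> \<gamma>) \<circ> (\<lambda>t. s - t) has_vector_derivative (- 1) *\<^sub>R D (s - t))
        (at t within {s - q..s - p})"
      by (rule vector_diff_chain_within)
    then show "(snd c \<circ> (\<lambda>t. \<gamma> (s - t)) has_vector_derivative - D (s - t))
        (at t within {s - q..s - p})"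
      by (simp add: comp_def)
  next
    have "continuous_on {t\<in>{s - q..s - p}. \<gamma> (s - t) \<in> fst c} (\<lambda>t. D (s - t))"
      by (rule continuous_on_compose2[OF contD cont]) auto
    then show "continuous_on {t\<in>{s - q..s - p}. \<gamma> (s - t) \<in> fst c} (\<lambda>t. - D (s - t))"
      by (rule continuous_on_minus)
  qed
qed

lemma piecewise_C1_path_reverse:
  assumes "piecewise_C1_path M A a b \<gamma>"
  shows "piecewise_C1_path M A a b (reverse_path a b \<gamma>)"
proof -
  obtain n :: nat and \<tau> where \<tau>: "\<tau> 0 = a" "\<tau> n = b" "\<forall>i<n. \<tau> i < \<tau> (Suc i)"
    and C1: "\<And>i. i < n \<Longrightarrow> C1_path M A (\<tau> i) (\<tau> (Suc i)) \<gamma>"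
    using assms unfolding piecewise_C1_path_def by blast
  let ?\<sigma> = "\<lambda>i. a + b - \<tau> (n - i)"
  have "continuous_map (top_of_set {a..b}) (top_of_set {a..b}) (\<lambda>t. a + b - t)"
    by (auto intro!: continuous_intros)
  then have "continuous_map (top_of_set {a..b}) M (\<gamma> \<circ> (\<lambda>t. a + b - t))"
    using assms unfolding piecewise_C1_path_def by (blast intro: continuous_map_compose)
  then have "continuous_map (top_of_set {a..b}) M (reverse_path a b \<gamma>)"
    by (simp add: comp_def reverse_path_def)
  moreover have "?\<sigma> i < ?\<sigma> (Suc i) \<and> C1_path M A (?\<sigma> i) (?\<sigma> (Suc i)) (reverse_path a b \<gamma>)"
    if "i < n" for i
  proof -
    define j where "j = n - Suc i"
    then have j: "n - i = Suc j" "n - Suc i = j" "j < n"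
      using that by simp_all
    then show ?thesis
      using \<tau>(3) C1_path_reverse[OF C1[OF j(3)], of "a + b"] by (simp add: reverse_path_def)
  qed
  moreover have "?\<sigma> 0 = a" "?\<sigma> n = b" using \<tau>(1,2) by simp_all
  moreover have "a < b" using assms unfolding piecewise_C1_path_def by blast
  ultimately show ?thesis
    unfolding piecewise_C1_path_def by (intro conjI exI[of _ n] exI[of _ ?\<sigma>]) blast+
qed

section \<open>Symmetrization of lengths and distances\<close>

text \<open>Both lengths are integrals over the regular times, where the integrands are measurable; the
  length of the reverse path becomes an integral along \<open>\<gamma>\<close> by the substitution
  \<open>t \<mapsto> a + b - t\<close>.\<close>

theorem Finsler_length_harmonic_sym_structure:
  fixes A :: "('a, 'e::euclidean_space) chart set"
  assumes M: "C1_manifold M A" and \<Omega>: "weak_Finsler_structure M A \<Omega>"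
    and meas: "lagrangian \<Omega> \<in> borel_measurable (tangent_bundle_borel M A)"
    and \<gamma>: "piecewise_C1_path M A a b \<gamma>"
  shows "Finsler_length A (harmonic_sym_structure M A \<Omega>) a b \<gamma> =
    arith_sym_length (Finsler_length A \<Omega>) a b \<gamma>"
proof -
  obtain U where U: "regular_times M A a b \<gamma> U"
    using piecewise_C1_path_regular_times[OF M \<gamma>] .
  have U': "open U" "U \<subseteq> {a..b}" "finite ({a..b} - U)" and ab: "a < b"
    using U \<gamma> unfolding regular_times_def piecewise_C1_path_def by blast+
  define v where "v = velocity A a b \<gamma>"
  \<comment> \<open>Cutting off outside \<open>U\<close> makes the integrands measurable on the whole real line, as the
    substitution requires.\<close>
  define p where "p r t = lagrangian \<Omega> (\<gamma> t, r *\<^sub>R v t) * indicator U t" for r :: real and t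
  have p_meas: "p r \<in> borel_measurable borel" for r
  proof -
    have "(\<lambda>t. lagrangian \<Omega> (\<gamma> t, r *\<^sub>R v t)) \<in> borel_measurable (restrict_space borel U)"
      unfolding v_def by (rule measurable_compose[OF lift_measurable[OF M \<gamma> U] meas])
    then show ?thesis
      using U'(1) unfolding p_def by (subst (asm) borel_measurable_restrict_space_iff_ennreal) auto
  qed
  have fwd: "Finsler_length A \<Omega> a b \<gamma> = (\<integral>\<^sup>+t. p 1 t \<partial>lborel)"
    unfolding Finsler_length_def p_def v_def
    by (rule nn_integral_cofinite_subset[OF U'(2,3)]) simp
  have bwd: "Finsler_length A \<Omega> a b (reverse_path a b \<gamma>) = (\<integral>\<^sup>+t. p (- 1) t \<partial>lborel)"
  proof -
    let ?V = "{t. a + b - t \<in> U}"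
    have "{a..b} - ?V \<subseteq> (\<lambda>t. a + b - t) ` ({a..b} - U)"
      by (auto intro!: image_eqI[of _ _ "a + b - x" for x])
    then have fin: "finite ({a..b} - ?V)"
      using U'(3) by (meson finite_imageI finite_subset)
    have sub: "?V \<subseteq> {a..b}"
    proof
      fix t assume "t \<in> ?V"
      then have "a + b - t \<in> {a..b}" using U'(2) by blast
      then show "t \<in> {a..b}" by simp
    qed
    have "Finsler_length A \<Omega> a b (reverse_path a b \<gamma>) =
        (\<integral>\<^sup>+t. lagrangian \<Omega> (\<gamma> (a + b - t), (- 1) *\<^sub>R v (a + b - t)) * indicator ?V t \<partial>lborel)"
      unfolding Finsler_length_def
    proof (rule nn_integral_cofinite_subset[OF sub fin])
      fix t assume "t \<in> ?V"
      then show "lagrangian \<Omega> (reverse_path a b \<gamma> t, velocity A a b (reverse_path a b \<gamma>) t) =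
          lagrangian \<Omega> (\<gamma> (a + b - t), (- 1) *\<^sub>R v (a + b - t))"
        using velocity_reverse_path[OF U ab, of t] by (simp add: v_def) (simp add: reverse_path_def)
    qed
    also have "\<dots> = (\<integral>\<^sup>+t. p (- 1) ((a + b) + (- 1) * t) \<partial>lborel)"
      unfolding p_def by (intro nn_integral_cong) (simp add: indicator_def)
    also have "\<dots> = (\<integral>\<^sup>+t. p (- 1) t \<partial>lborel)"
      using nn_integral_real_affine[OF p_meas, of "- 1" "- 1" "a + b"] by simp
    finally show ?thesis .
  qed
  have "Finsler_length A (harmonic_sym_structure M A \<Omega>) a b \<gamma> =
      (\<integral>\<^sup>+t. (lagrangian \<Omega> (\<gamma> t, v t) + lagrangian \<Omega> (\<gamma> t, - v t)) / 2 * indicator U t \<partial>lborel)"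
    unfolding Finsler_length_def v_def
  proof (rule nn_integral_cofinite_subset[OF U'(2,3)])
    fix t assume "t \<in> U"
    then have "(\<gamma> t, velocity A a b \<gamma> t) \<in> tangent_bundle M A"
      using lift_in_tangent_bundle[OF M \<gamma> U, of t 1] by simp
    then show "lagrangian (harmonic_sym_structure M A \<Omega>) (\<gamma> t, velocity A a b \<gamma> t) =
        (lagrangian \<Omega> (\<gamma> t, velocity A a b \<gamma> t) + lagrangian \<Omega> (\<gamma> t, - velocity A a b \<gamma> t)) / 2"
      by (rule lagrangian_harmonic_sym_structure[OF M \<Omega>])
  qed
  also have "\<dots> = (\<integral>\<^sup>+t. (p 1 t + p (- 1) t) / 2 \<partial>lborel)"
    unfolding p_def by (intro nn_integral_cong) (simp add: indicator_def)
  also have "\<dots> = (\<integral>\<^sup>+t. p 1 t + p (- 1) t \<partial>lborel) / 2"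
    using p_meas by (intro nn_integral_divide borel_measurable_add) simp_all
  also have "(\<integral>\<^sup>+t. p 1 t + p (- 1) t \<partial>lborel) = (\<integral>\<^sup>+t. p 1 t \<partial>lborel) + (\<integral>\<^sup>+t. p (- 1) t \<partial>lborel)"
    using p_meas by (intro nn_integral_add) simp_all
  finally show ?thesis by (simp add: arith_sym_length_def fwd bwd)
qed

lemma Finsler_dist_le:
  "piecewise_C1_path M A a b \<gamma> \<Longrightarrow> \<gamma> a = x \<Longrightarrow> \<gamma> b = y \<Longrightarrow>
    Finsler_dist M A \<Omega> x y \<le> Finsler_length A \<Omega> a b \<gamma>"
  unfolding Finsler_dist_def by (rule Inf_lower) blast

theorem theorem1:
  fixes M :: "'a topology"
    and A :: "('a, 'e::euclidean_space) chart set"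
    and \<Omega> :: "('a \<times> ('a, 'e) tvec) set"
  assumes "C1_manifold M A"
    and "weak_Finsler_structure M A \<Omega>"
    and "lagrangian \<Omega> \<in> borel_measurable (tangent_bundle_borel M A)"
  shows "(\<forall>a b \<gamma>. piecewise_C1_path M A a b \<gamma> \<longrightarrow>
           Finsler_length A (harmonic_sym_structure M A \<Omega>) a b \<gamma> =
           arith_sym_length (Finsler_length A \<Omega>) a b \<gamma>) \<and>
         ((\<forall>x\<in>topspace M. \<forall>y\<in>topspace M. \<exists>a b \<gamma>. bi_minimal M A \<Omega> x y a b \<gamma>) \<longrightarrow>
         (\<forall>x\<in>topspace M. \<forall>y\<in>topspace M.
           Finsler_dist M A (harmonic_sym_structure M A \<Omega>) x y =
           arith_sym_dist (Finsler_dist M A \<Omega>) x y))"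
proof (intro conjI allI impI ballI)
  show length: "Finsler_length A (harmonic_sym_structure M A \<Omega>) a b \<gamma> =
      arith_sym_length (Finsler_length A \<Omega>) a b \<gamma>" if "piecewise_C1_path M A a b \<gamma>" for a b \<gamma>
    using Finsler_length_harmonic_sym_structure[OF assms that] .
  fix x y
  assume "\<forall>x\<in>topspace M. \<forall>y\<in>topspace M. \<exists>a b \<gamma>. bi_minimal M A \<Omega> x y a b \<gamma>"
    and "x \<in> topspace M" "y \<in> topspace M"
  then obtain a b \<gamma> where "bi_minimal M A \<Omega> x y a b \<gamma>" by blast
  then have \<gamma>: "piecewise_C1_path M A a b \<gamma>" "\<gamma> a = x" "\<gamma> b = y"
    and min: "Finsler_length A \<Omega> a b \<gamma> = Finsler_dist M A \<Omega> x y"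
      "Finsler_length A \<Omega> a b (reverse_path a b \<gamma>) = Finsler_dist M A \<Omega> y x"
    unfolding bi_minimal_def by blast+
  show "Finsler_dist M A (harmonic_sym_structure M A \<Omega>) x y =
      arith_sym_dist (Finsler_dist M A \<Omega>) x y"
  proof (rule antisym)
    show "Finsler_dist M A (harmonic_sym_structure M A \<Omega>) x y \<le>
        arith_sym_dist (Finsler_dist M A \<Omega>) x y"
      using Finsler_dist_le[OF \<gamma>, of "harmonic_sym_structure M A \<Omega>"]
      by (simp add: length[OF \<gamma>(1)] arith_sym_length_def arith_sym_dist_def min)
    \<comment> \<open>The reverse of a competitor from \<open>x\<close> to \<open>y\<close> is a competitor from \<open>y\<close> to \<open>x\<close>.\<close>
    show "arith_sym_dist (Finsler_dist M A \<Omega>) x y \<le>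
        Finsler_dist M A (harmonic_sym_structure M A \<Omega>) x y"
      unfolding Finsler_dist_def[of M A "harmonic_sym_structure M A \<Omega>"]
    proof (rule Inf_greatest, clarify)
      fix a b and \<delta> :: "real \<Rightarrow> 'a" assume \<delta>: "piecewise_C1_path M A a b \<delta>"
      have "Finsler_dist M A \<Omega> (\<delta> a) (\<delta> b) \<le> Finsler_length A \<Omega> a b \<delta>"
        by (rule Finsler_dist_le[OF \<delta>]) simp_all
      moreover have "Finsler_dist M A \<Omega> (\<delta> b) (\<delta> a) \<le> Finsler_length A \<Omega> a b (reverse_path a b \<delta>)"
        by (rule Finsler_dist_le[OF piecewise_C1_path_reverse[OF \<delta>]]) (simp_all add: reverse_path_def)
      ultimately show "arith_sym_dist (Finsler_dist M A \<Omega>) (\<delta> a) (\<delta> b) \<le>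
          Finsler_length A (harmonic_sym_structure M A \<Omega>) a b \<delta>"
        unfolding length[OF \<delta>] arith_sym_length_def arith_sym_dist_def
        by (intro divide_right_mono_ennreal add_mono)
    qed
  qed
qed

end
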